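(* The convergence exponent $\lambda^* \colon [0,1] \to [0,1]$ is not of Baire class one on $[0,1]$.
   Context: Pierce digits. For $x \in [0,1]$, define $d_1(x) := \lfloor 1/x \rfloor$ and $T(x) := 1 - d_1(x)\,x$ if $x \neq 0$, and $d_1(0) := \infty$, $T(0) := 0$. Here $\lfloor y \rfloor$ is the largest integer not exceeding $y$. For $n \in \mathbb{N} = \{1,2,3,\dots\}$ put $d_n(x) := d_1(T^{n-1}(x))$, where $T^{n-1}$ is the $(n-1)$-fold iterate of $T$ ($T^0$ is the identity). The sequence $(d_n(x))_{n \in \mathbb{N}}$ is the Pierce expansion digit sequence of $x$. Conventions: $\infty^s := \infty$ for $s>0$ and $c/\infty := 0$ for $c \in \mathbb{R}$. Convergence exponent: for $x \in [0,1]$, $\lambda^*(x) := \inf\{ s > 0 : \sum_{n \in \mathbb{N}} 1/(d_n(x))^s \text{ converges} \}$. The function $\lambda^*$ takes values in $[0,1]$. A function $g \colon X \to \mathbb{R}$ on a metrizable space $X$ is of Baire class one (on $X$) if there is a sequence $(g_n)_{n \in \mathbb{N}}$ of real-valued continuous functions on $X$ with $g_n \to g$ pointwise everywhere on $X$. The interval $[0,1]$ carries the subspace topology induced by the standard topology of $\mathbb{R}$. *)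

theory Defs
  imports "HOL-Analysis.Analysis" "HOL-Library.Extended_Nat" "HOL-Library.Extended_Real"
begin

definition pierce_first_digit :: "real \<Rightarrow> enat" where
  "pierce_first_digit x = (if x = 0 then \<infinity> else enat (nat \<lfloor>1 / x\<rfloor>))"

definition pierce_map :: "real \<Rightarrow> real" where
  "pierce_map x = (if x = 0 then 0 else 1 - real (the_enat (pierce_first_digit x)) * x)"

text \<open>Digits are indexed from 1; the value at index 0 is irrelevant.\<close>

definition pierce_digit :: "nat \<Rightarrow> real \<Rightarrow> enat" where
  "pierce_digit n x = pierce_first_digit ((pierce_map ^^ (n - 1)) x)"

definition digit_powr :: "enat \<Rightarrow> real \<Rightarrow> ereal" where
  "digit_powr d s = (case d of enat k \<Rightarrow> ereal (real k powr s) | \<infinity> \<Rightarrow> \<infinity>)"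

text \<open>On \<open>[0,1]\<close> all digits are at least 1, so every term below is a finite
  extended real (with \<open>1 / \<infinity> = 0\<close>) and \<open>real_of_ereal\<close> loses nothing. The infimum is over
  a nonempty set bounded below, see \<open>convergence_exponent_in_unit\<close>.\<close>

definition convergence_exponent :: "real \<Rightarrow> real" where
  "convergence_exponent x =
     Inf {s. s > 0 \<and> summable (\<lambda>n. real_of_ereal (1 / digit_powr (pierce_digit (Suc n) x) s))}"

definition baire_class_one_on :: "'a::metric_space set \<Rightarrow> ('a \<Rightarrow> real) \<Rightarrow> bool" where
  "baire_class_one_on X g \<longleftrightarrow>
     (\<exists>h :: nat \<Rightarrow> 'a \<Rightarrow> real. (\<forall>n. continuous_on X (h n)) \<and>
        (\<forall>x\<in>X. (\<lambda>n. h n x) \<longlonglongrightarrow> g x))"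

lemma pierce_step:
  assumes "0 < x" "x \<le> 1"
  shows "0 \<le> pierce_map x" "pierce_map x < 1 / (real_of_int \<lfloor>1 / x\<rfloor> + 1)"
    and "1 \<le> \<lfloor>1 / x\<rfloor>"
proof -
  define k where "k = \<lfloor>1 / x\<rfloor>"
  show k1: "1 \<le> \<lfloor>1 / x\<rfloor>" using assms by (simp add: le_floor_iff)
  then have k: "pierce_map x = 1 - real_of_int k * x"
    using assms by (simp add: pierce_map_def pierce_first_digit_def k_def)
  have "real_of_int k \<le> 1 / x" by (simp add: k_def)
  then have "real_of_int k * x \<le> 1" using assms by (simp add: field_simps)
  then show "0 \<le> pierce_map x" using k by simp
  have "1 / x < real_of_int k + 1" unfolding k_def by linarith
  then have "1 < (real_of_int k + 1) * x" using assms by (simp add: field_simps)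
  moreover have "0 < real_of_int k + 1" using k1 k_def by linarith
  ultimately have "(1 - real_of_int k * x) * (real_of_int k + 1) < 1"
    using k1 k_def mult_strict_left_mono[of 1 "(real_of_int k + 1) * x" "real_of_int k"]
    by (simp add: algebra_simps)
  then show "pierce_map x < 1 / (real_of_int \<lfloor>1 / x\<rfloor> + 1)"
    using k \<open>0 < real_of_int k + 1\<close> by (simp add: k_def pos_less_divide_eq)
qed

lemma pierce_iterate_bound:
  assumes "x \<in> {0..1}"
  shows "(pierce_map ^^ n) x \<in> {0..1 / real (Suc n)}"
proof (induction n)
  case 0
  then show ?case using assms by simp
next
  case (Suc n)
  define y where "y = (pierce_map ^^ n) x"
  have y: "0 \<le> y" "y \<le> 1 / real (Suc n)" using Suc by (auto simp: y_def)
  show ?case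
  proof (cases "y = 0")
    case True
    have "pierce_map 0 = 0" by (simp add: pierce_map_def)
    then show ?thesis using True y_def by simp
  next
    case False
    then have y0: "0 < y" using y by simp
    have "1 / real (Suc n) \<le> 1" by simp
    then have y1: "y \<le> 1" using y by linarith
    have "real (Suc n) \<le> 1 / y" using y y0 by (simp add: field_simps)
    then have "int (Suc n) \<le> \<lfloor>1 / y\<rfloor>" by (simp add: le_floor_iff)
    then have "real (Suc n) \<le> real_of_int \<lfloor>1 / y\<rfloor>" by linarith
    then have "1 / (real_of_int \<lfloor>1 / y\<rfloor> + 1) \<le> 1 / real (Suc (Suc n))"
      by (intro divide_left_mono) auto
    then have "pierce_map y \<in> {0..1 / real (Suc (Suc n))}"
      using pierce_step[OF y0 y1] by (simp del: of_nat_Suc)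
    then show ?thesis by (simp add: y_def del: of_nat_Suc)
  qed
qed

lemma pierce_digit_ge:
  assumes "x \<in> {0..1}"
  shows "enat (Suc n) \<le> pierce_digit (Suc n) x"
proof -
  define y where "y = (pierce_map ^^ n) x"
  have y: "0 \<le> y" "y \<le> 1 / real (Suc n)" using pierce_iterate_bound[OF assms] by (auto simp: y_def)
  show ?thesis
  proof (cases "y = 0")
    case True
    then show ?thesis by (simp add: pierce_digit_def y_def[symmetric] pierce_first_digit_def)
  next
    case False
    then have "real (Suc n) \<le> 1 / y" using y by (simp add: field_simps)
    then have "int (Suc n) \<le> \<lfloor>1 / y\<rfloor>" by (simp add: le_floor_iff)
    then have "Suc n \<le> nat \<lfloor>1 / y\<rfloor>" by linarith
    then show ?thesis using False
      by (simp add: pierce_digit_def y_def[symmetric] pierce_first_digit_def)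
  qed
qed

lemma pierce_summable:
  assumes "x \<in> {0..1}" "s > 1"
  shows "summable (\<lambda>n. real_of_ereal (1 / digit_powr (pierce_digit (Suc n) x) s))"
proof (rule summable_comparison_test')
  have "summable (\<lambda>n. real n powr (- s))" using assms by (simp add: summable_real_powr_iff)
  then show "summable (\<lambda>n. real (Suc n) powr (- s))" by (subst summable_Suc_iff)
next
  fix n :: nat
  show "norm (real_of_ereal (1 / digit_powr (pierce_digit (Suc n) x) s)) \<le> real (Suc n) powr (- s)"
  proof (cases "pierce_digit (Suc n) x")
    case (enat k)
    then have k: "Suc n \<le> k" using pierce_digit_ge[OF assms(1), of n] by simp
    then have "real k powr (- s) \<le> real (Suc n) powr (- s)"
      using assms by (intro powr_mono2') auto
    moreover have "real_of_ereal (1 / digit_powr (pierce_digit (Suc n) x) s) = real k powr (- s)"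
      using k by (simp add: enat digit_powr_def powr_minus_divide one_ereal_def)
    ultimately show ?thesis by simp
  next
    case infinity
    then show ?thesis by (simp add: digit_powr_def)
  qed
qed

lemma convergence_exponent_in_unit:
  assumes "x \<in> {0..1}"
  shows "convergence_exponent x \<in> {0..1}"
proof -
  let ?S = "{s. s > 0 \<and> summable (\<lambda>n. real_of_ereal (1 / digit_powr (pierce_digit (Suc n) x) s))}"
  have mem: "s \<in> ?S" if "s > 1" for s using that pierce_summable[OF assms that] by simp
  have bdd: "bdd_below ?S" by (rule bdd_belowI[of _ 0]) auto
  have "2 \<in> ?S" by (rule mem) simp
  then have "?S \<noteq> {}" by blast
  then have "0 \<le> Inf ?S" by (rule cInf_greatest) auto
  moreover have "Inf ?S \<le> 1"
  proof (rule dense_ge)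
    fix s :: real assume "1 < s"
    then show "Inf ?S \<le> s" by (intro cInf_lower[OF mem bdd])
  qed
  ultimately show ?thesis by (simp add: convergence_exponent_def)
qed

end

theory Submission
  imports Defs
begin

text \<open>
  On a nonempty closed subset of a Euclidean space, a pointwise limit of continuous functions
  cannot be small on one dense set and large on another: by the Baire category theorem the
  approximating sequence would take both small and large values infinitely often at some point
  (\<open>not_baire_class_one_if_dense_gap\<close>).  So it suffices that both \<open>\<lambda>\<^sup>* = 0\<close> and \<open>\<lambda>\<^sup>* = 1\<close> hold on
  dense subsets of \<open>[0,1]\<close>.

  Applying the Pierce map deletes the first digit, so \<open>\<lambda>\<^sup>*\<close> is invariant under it and its level
  sets are closed under preimages.  A set that is closed under preimages is dense in \<open>[0,1]\<close> as soon
  as its closure contains \<open>0\<close> (\<open>backward_closed_dense\<close>): every rational reaches \<open>0\<close> in finitely many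
  steps, and points near \<open>0\<close> can be pulled back along the inverse branches
  \<open>y \<mapsto> (1 - y) / d\<close>.  The level set of \<open>0\<close> contains \<open>0\<close> itself.  For the level set of \<open>1\<close> one
  point is enough, because its iterates stay in the level set and tend to \<open>0\<close>; the point \<open>1 - 1/e\<close> has the
  digits \<open>1, 2, 3, \<dots>\<close>, and \<open>\<Sum> 1 / n\<^sup>s\<close> converges exactly for \<open>s > 1\<close>.
\<close>

section \<open>An obstruction to being of Baire class one\<close>

text \<open>For approximants \<open>h n\<close> and thresholds \<open>c < d\<close> strictly between \<open>a\<close> and \<open>b\<close>, the points at
  which some late \<open>h n\<close> is below \<open>c\<close> form an open dense set, and likewise for above \<open>d\<close>.
  A point in all of these sets is one where \<open>h n\<close> oscillates forever.\<close>

lemma not_baire_class_one_if_dense_gap: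
  fixes S :: "'a::{real_normed_vector,heine_borel} set" and g :: "'a \<Rightarrow> real"
  assumes "closed S" "S \<noteq> {}" "a < b"
    and low: "S \<subseteq> closure {x \<in> S. g x \<le> a}"
    and high: "S \<subseteq> closure {x \<in> S. b \<le> g x}"
  shows "\<not> baire_class_one_on S g"
proof
  assume "baire_class_one_on S g"
  then obtain h where cont: "\<And>n. continuous_on S (h n)"
    and lim: "\<And>x. x \<in> S \<Longrightarrow> (\<lambda>n. h n x) \<longlonglongrightarrow> g x"
    unfolding baire_class_one_on_def by blast
  obtain c where c: "a < c" "c < b" using dense[OF \<open>a < b\<close>] by blast
  obtain d where d: "c < d" "d < b" using dense[OF c(2)] by blast
  define L where "L N = {x \<in> S. \<exists>n\<ge>N. h n x < c}" for N
  define H where "H N = {x \<in> S. \<exists>n\<ge>N. d < h n x}" for N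
  have "openin (top_of_set S) (L N)" for N
  proof -
    have "L N = (\<Union>n\<in>{N..}. S \<inter> h n -` {..<c})" by (auto simp: L_def)
    also have "openin (top_of_set S) \<dots>"
      by (intro openin_Union ballI) (auto intro: continuous_openin_preimage_gen cont simp del: Int_UN_distrib)
    finally show ?thesis .
  qed
  moreover have "openin (top_of_set S) (H N)" for N
  proof -
    have "H N = (\<Union>n\<in>{N..}. S \<inter> h n -` {d<..})" by (auto simp: H_def)
    also have "openin (top_of_set S) \<dots>"
      by (intro openin_Union ballI) (auto intro: continuous_openin_preimage_gen cont simp del: Int_UN_distrib)
    finally show ?thesis .
  qed
  moreover have "S \<subseteq> closure (L N)" for N
  proof -
    have "{x \<in> S. g x \<le> a} \<subseteq> L N"
    proof
      fix x assume x: "x \<in> {x \<in> S. g x \<le> a}"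
      then have "eventually (\<lambda>n. h n x < c) sequentially"
        using order_tendstoD(2)[OF lim] c(1) by simp
      then obtain M where "\<And>n. n \<ge> M \<Longrightarrow> h n x < c" by (auto simp: eventually_sequentially)
      then have "h (max M N) x < c" by simp
      then show "x \<in> L N" using x by (auto simp: L_def intro!: exI[of _ "max M N"])
    qed
    then show ?thesis using low closure_mono by blast
  qed
  moreover have "S \<subseteq> closure (H N)" for N
  proof -
    have "{x \<in> S. b \<le> g x} \<subseteq> H N"
    proof
      fix x assume x: "x \<in> {x \<in> S. b \<le> g x}"
      then have "eventually (\<lambda>n. d < h n x) sequentially"
        using order_tendstoD(1)[OF lim] d(2) by simp
      then obtain M where "\<And>n. n \<ge> M \<Longrightarrow> d < h n x" by (auto simp: eventually_sequentially)
      then have "d < h (max M N) x" by simp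
      then show "x \<in> H N" using x by (auto simp: H_def intro!: exI[of _ "max M N"])
    qed
    then show ?thesis using high closure_mono by blast
  qed
  ultimately have "S \<subseteq> closure (\<Inter>(range L \<union> range H))"
    using \<open>closed S\<close> by (intro Baire) (simp, simp, blast)
  then have "\<Inter>(range L \<union> range H) \<noteq> {}" using \<open>S \<noteq> {}\<close> by force
  then obtain x where "x \<in> \<Inter>(range L \<union> range H)" by (meson ex_in_conv)
  then have x: "x \<in> L N" "x \<in> H N" for N by auto
  from x(1) have "x \<in> S" by (simp add: L_def)
  have "frequently (\<lambda>n. h n x < c) sequentially"
    using x(1) by (auto simp: L_def frequently_sequentially)
  then have "\<not> c < g x"
    using order_tendstoD(1)[OF lim[OF \<open>x \<in> S\<close>], of c]
    unfolding frequently_def by (metis (mono_tags, lifting) eventually_mono less_asym)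
  moreover have "frequently (\<lambda>n. d < h n x) sequentially"
    using x(2) by (auto simp: H_def frequently_sequentially)
  then have "\<not> g x < d"
    using order_tendstoD(2)[OF lim[OF \<open>x \<in> S\<close>], of d]
    unfolding frequently_def by (metis (mono_tags, lifting) eventually_mono less_asym)
  ultimately show False using d(1) by linarith
qed

section \<open>Pierce dynamics\<close>

text \<open>At the excluded endpoint \<open>y = 1 / (d + 1)\<close> the branch would return \<open>1 / (d + 1)\<close>, whose
  first digit is \<open>d + 1\<close>; larger values of \<open>y\<close> give even smaller points.\<close>

lemma pierce_inverse_branch:
  assumes "1 \<le> d" "0 \<le> y" "y < 1 / (real d + 1)"
  shows "pierce_first_digit ((1 - y) / real d) = enat d"
    and "pierce_map ((1 - y) / real d) = y"
    and "(1 - y) / real d \<in> {0..1}"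
proof -
  have "1 / (real d + 1) \<le> 1" by simp
  then have y1: "y < 1" using assms(3) by linarith
  have "y * (real d + 1) < 1" using assms by (simp add: field_simps)
  then have "\<lfloor>real d / (1 - y)\<rfloor> = int d"
    using assms y1 by (simp add: floor_eq_iff field_simps)
  then show digit: "pierce_first_digit ((1 - y) / real d) = enat d"
    using assms y1 by (simp add: pierce_first_digit_def)
  show "pierce_map ((1 - y) / real d) = y"
    unfolding pierce_map_def digit using assms y1 by simp
  show "(1 - y) / real d \<in> {0..1}" using assms y1 by (simp add: field_simps)
qed

text \<open>With a fixed denominator, the Pierce map performs a division with remainder on numerators,
  so these strictly decrease until they vanish.\<close>

lemma pierce_orbit_of_fraction_reaches_0:
  assumes "0 < q"
  shows "\<exists>n. (pierce_map ^^ n) (real p / real q) = 0"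
proof (induction p rule: less_induct)
  case (less p)
  show ?case
  proof (cases "p = 0")
    case True
    then have "(pierce_map ^^ 0) (real p / real q) = 0" by simp
    then show ?thesis by blast
  next
    case False
    have "\<lfloor>real q / real p\<rfloor> = int (q div p)" by (rule floor_divide_of_nat_eq)
    then have "pierce_map (real p / real q) = 1 - real (q div p) * (real p / real q)"
      using False assms by (simp add: pierce_map_def pierce_first_digit_def)
    also have "\<dots> = (real q - real (q div p * p)) / real q"
      using assms by (simp add: field_simps)
    also have "real q - real (q div p * p) = real (q mod p)"
      by (metis add_diff_cancel_left' div_mult_mod_eq of_nat_add)
    finally have step: "pierce_map (real p / real q) = real (q mod p) / real q" .
    obtain n where "(pierce_map ^^ n) (real (q mod p) / real q) = 0"
      using less.IH[of "q mod p"] False by auto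
    then have "(pierce_map ^^ Suc n) (real p / real q) = 0"
      by (simp add: funpow_Suc_right step del: funpow.simps)
    then show ?thesis by blast
  qed
qed

text \<open>If the orbit of \<open>r\<close> ends in \<open>0\<close>, the closure of \<open>A\<close> spreads backwards along it: an
  approximation of the image of a point is carried to an approximation of the point itself by
  the continuous inverse branch of the digit concerned.\<close>

lemma backward_closed_dense:
  assumes preimage: "\<And>x. x \<in> {0..1} \<Longrightarrow> pierce_map x \<in> A \<Longrightarrow> x \<in> A"
    and unit: "A \<subseteq> {0..1}"
    and zero: "0 \<in> closure A"
  shows "{0..1} \<subseteq> closure A"
proof -
  have orbit: "r \<in> closure A" if "(pierce_map ^^ n) r = 0" "r \<in> {0..1}" for n r
    using that
  proof (induction n arbitrary: r)
    case 0
    then show ?case using zero by simp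
  next
    case (Suc n)
    show ?case
    proof (cases "r = 0")
      case True
      then show ?thesis using zero by simp
    next
      case False
      then have r: "0 < r" "r \<le> 1" using Suc.prems by auto
      define y where "y = pierce_map r"
      define d where "d = nat \<lfloor>1 / r\<rfloor>"
      have d1: "1 \<le> d" using pierce_step(3)[OF r] unfolding d_def by linarith
      have dr: "real d = real_of_int \<lfloor>1 / r\<rfloor>"
        using pierce_step(3)[OF r] unfolding d_def by linarith
      have yd: "0 \<le> y" "y < 1 / (real d + 1)"
        using pierce_step[OF r] by (simp_all add: y_def dr)
      have "1 / (real d + 1) \<le> 1" by simp
      then have "y \<le> 1" using yd(2) by linarith
      then have "y \<in> {0..1}" using yd(1) by simp
      moreover have "(pierce_map ^^ n) y = 0"
        using Suc.prems(1) by (simp add: funpow_Suc_right y_def del: funpow.simps)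
      ultimately have "y \<in> closure A" using Suc.IH by blast
      then obtain z where z: "\<And>i. z i \<in> A" "z \<longlonglongrightarrow> y"
        by (auto simp: closure_sequential)
      have "y = 1 - real d * r"
        using False by (simp add: y_def d_def pierce_map_def pierce_first_digit_def)
      then have ry: "r = (1 - y) / real d" using d1 by simp
      have "(\<lambda>i. (1 - z i) / real d) \<longlonglongrightarrow> r"
        unfolding ry using d1 by (intro tendsto_intros z) auto
      moreover have "eventually (\<lambda>i. (1 - z i) / real d \<in> closure A) sequentially"
        using order_tendstoD(2)[OF z(2) yd(2)]
      proof eventually_elim
        case (elim i)
        have "0 \<le> z i" using z(1)[of i] unit by auto
        note branch = pierce_inverse_branch[OF d1 this elim]
        have "(1 - z i) / real d \<in> A"
          using preimage[OF branch(3)] branch(2) z(1)[of i] by simp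
        then show ?case using closure_subset by blast
      qed
      ultimately show ?thesis
        by (intro Lim_in_closed_set[OF closed_closure]) auto
    qed
  qed
  (* The interior suffices: between 0 and x there is a rational arbitrarily close to x, and its
     orbit ends in 0. *)
  have "x \<in> closure (closure A)" if "x \<in> {0<..<1}" for x
    unfolding closure_approachable
  proof (intro allI impI)
    fix e :: real assume "0 < e"
    then have "max 0 (x - e) < x" using that by simp
    then obtain r where r: "r \<in> \<rat>" "max 0 (x - e) < r" "r < x"
      using Rats_dense_in_real by blast
    then obtain p q :: nat where pq: "q \<noteq> 0" "\<bar>r\<bar> = real p / real q"
      by (elim Rats_abs_nat_div_natE)
    then obtain n where "(pierce_map ^^ n) r = 0"
      using pierce_orbit_of_fraction_reaches_0[of q p] r by auto
    then have "r \<in> closure A" using orbit r that by auto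
    moreover have "dist r x < e" using r by (simp add: dist_real_def)
    ultimately show "\<exists>y\<in>closure A. dist y x < e" by blast
  qed
  then have "closure {0<..<1} \<subseteq> closure A"
    by (intro closure_minimal) auto
  then show ?thesis by simp
qed

section \<open>Level sets of the convergence exponent\<close>

lemma convergence_exponent_pierce_map:
  "convergence_exponent (pierce_map x) = convergence_exponent x"
proof -
  have "pierce_digit (Suc n) (pierce_map x) = pierce_digit (Suc (Suc n)) x" for n
    by (simp add: pierce_digit_def funpow_Suc_right del: funpow.simps)
  then have "summable (\<lambda>n. real_of_ereal (1 / digit_powr (pierce_digit (Suc n) (pierce_map x)) s))
      \<longleftrightarrow> summable (\<lambda>n. real_of_ereal (1 / digit_powr (pierce_digit (Suc n) x) s))" for s
    using summable_Suc_iff[of "\<lambda>n. real_of_ereal (1 / digit_powr (pierce_digit (Suc n) x) s)"]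
    by simp
  then show ?thesis by (simp add: convergence_exponent_def)
qed

lemma convergence_exponent_0: "convergence_exponent 0 = 0"
proof -
  have "(pierce_map ^^ n) 0 = 0" for n by (induction n) (auto simp: pierce_map_def)
  then have "pierce_digit (Suc n) 0 = \<infinity>" for n
    by (simp add: pierce_digit_def pierce_first_digit_def)
  then have "convergence_exponent 0 = Inf {0<..}"
    by (simp add: convergence_exponent_def digit_powr_def greaterThan_def)
  then show ?thesis by simp
qed

text \<open>Integration by parts gives \<open>I (n + 1) = 1 - (n + 1) * I n\<close> for
  \<open>I n = \<integral>\<^sub>0\<^sup>1 u\<^sup>n e\<^sup>u\<^sup>-\<^sup>1 du\<close>, which is the action of the Pierce map at a point with
  first digit \<open>n + 1\<close>.  Thus \<open>I 0 = 1 - 1/e\<close> runs through the digits \<open>1, 2, 3, \<dots>\<close>.\<close>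

lemma ex_convergence_exponent_eq_1:
  "\<exists>x\<in>{0..1}. convergence_exponent x = 1"
proof -
  define f :: "nat \<Rightarrow> real \<Rightarrow> real" where "f n u = u ^ n * exp (u - 1)" for n u
  define I where "I n = integral {0..1} (f n)" for n
  have int: "f n integrable_on {0..1}" for n
    unfolding f_def by (intro integrable_continuous_interval continuous_intros)
  have rec: "I (Suc n) = 1 - real (Suc n) * I n" for n
  proof -
    have "((\<lambda>u. real (Suc n) * f n u + f (Suc n) u) has_integral f (Suc n) 1 - f (Suc n) 0) {0..1}"
      by (rule fundamental_theorem_of_calculus)
         (auto simp: f_def has_real_derivative_iff_has_vector_derivative[symmetric]
               simp del: power_Suc of_nat_Suc intro!: derivative_eq_intros)
    moreover have "((\<lambda>u. real (Suc n) * f n u + f (Suc n) u)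
        has_integral real (Suc n) * I n + I (Suc n)) {0..1}"
      unfolding I_def by (intro has_integral_add has_integral_mult_right integrable_integral int)
    ultimately have "real (Suc n) * I n + I (Suc n) = f (Suc n) 1 - f (Suc n) 0"
      by (rule has_integral_unique[symmetric])
    then show ?thesis by (simp add: f_def)
  qed
  have pos: "0 \<le> I n" for n
    unfolding I_def by (intro integral_nonneg int) (auto simp: f_def)
  have upper: "I n \<le> 1 / real (Suc n)" for n
    using rec[of n] pos[of "Suc n"] by (simp add: field_simps)
  have I_branch: "I n = (1 - I (Suc n)) / real (Suc n)" for n
    using rec[of n] by (simp add: field_simps)
  have lower: "1 / real (Suc (Suc n)) \<le> I n" for n
  proof -
    have "1 / real (Suc (Suc n)) = (1 - 1 / real (Suc (Suc n))) / real (Suc n)"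
      by (simp add: diff_divide_eq_iff)
    also have "\<dots> \<le> I n"
      unfolding I_branch[of n] using upper[of "Suc n"] by (intro divide_right_mono) simp_all
    finally show ?thesis .
  qed
  (* The first digit of I n is n + 1 only if I n exceeds 1 / (n + 2) strictly, which needs
     I (n + 1) < 1 / (n + 2).  Equality in the upper bound for I n would make I (n + 1)
     vanish, against its lower bound. *)
  have strict: "I n < 1 / real (Suc n)" for n
  proof -
    have "0 < 1 / real (Suc (Suc (Suc n)))" by simp
    then have "0 < I (Suc n)" using lower[of "Suc n"] by linarith
    then show ?thesis using rec[of n] by (simp add: field_simps)
  qed
  have bound: "I (Suc n) < 1 / (real (Suc n) + 1)" for n
    using strict[of "Suc n"] by (simp add: add.commute)
  have branch: "pierce_first_digit (I n) = enat (Suc n)" "pierce_map (I n) = I (Suc n)" for n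
    using pierce_inverse_branch(1,2)[OF _ pos bound[of n]] by (simp_all add: I_branch[of n])
  have "(pierce_map ^^ n) (I 0) = I n" for n
    by (induction n) (simp_all add: branch)
  then have digit: "pierce_digit (Suc n) (I 0) = enat (Suc n)" for n
    by (simp add: pierce_digit_def branch)
  have "summable (\<lambda>n. real_of_ereal (1 / digit_powr (pierce_digit (Suc n) (I 0)) s)) \<longleftrightarrow> 1 < s"
    for s
  proof -
    have "real_of_ereal (1 / digit_powr (pierce_digit (Suc n) (I 0)) s) = real (Suc n) powr (- s)"
      for n
      by (simp add: digit digit_powr_def powr_minus_divide one_ereal_def)
    then show ?thesis
      using summable_Suc_iff[of "\<lambda>n. real n powr (- s)"] by (simp add: summable_real_powr_iff)
  qed
  then have "convergence_exponent (I 0) = Inf {s. 0 < s \<and> 1 < s}"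
    by (simp add: convergence_exponent_def)
  also have "{s::real. 0 < s \<and> 1 < s} = {1<..}" by auto
  finally have "convergence_exponent (I 0) = 1" by simp
  then show ?thesis using pos[of 0] upper[of 0] by auto
qed

theorem corollary1p5:
  shows "\<not> baire_class_one_on {0..1::real} convergence_exponent"
proof -
  have preimage: "convergence_exponent x = v" if "convergence_exponent (pierce_map x) = v" for x v
    using that by (simp add: convergence_exponent_pierce_map)
  have "{0..1} \<subseteq> closure {x \<in> {0..1}. convergence_exponent x = 0}"
  proof (rule backward_closed_dense)
    show "0 \<in> closure {x \<in> {0..1}. convergence_exponent x = 0}"
      using convergence_exponent_0 by (intro subsetD[OF closure_subset]) simp
  qed (auto intro: preimage)
  moreover have "{0..1} \<subseteq> closure {x \<in> {0..1}. convergence_exponent x = 1}"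
  proof (rule backward_closed_dense)
    obtain x where x: "x \<in> {0..1}" "convergence_exponent x = 1"
      using ex_convergence_exponent_eq_1 by blast
    have bound: "0 \<le> (pierce_map ^^ n) x" "(pierce_map ^^ n) x \<le> 1 / real (Suc n)" for n
      using pierce_iterate_bound[OF x(1), of n] by simp_all
    have "(\<lambda>n. (pierce_map ^^ n) x) \<longlonglongrightarrow> 0"
      by (rule tendsto_sandwich[OF _ _ tendsto_const LIMSEQ_Suc[OF lim_1_over_n]])
         (use bound in auto)
    moreover have "(pierce_map ^^ n) x \<in> {x \<in> {0..1}. convergence_exponent x = 1}" for n
    proof -
      have "convergence_exponent ((pierce_map ^^ n) x) = 1"
        by (induction n) (simp_all add: x(2) convergence_exponent_pierce_map)
      moreover have "1 / real (Suc n) \<le> 1" by simp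
      then have "(pierce_map ^^ n) x \<le> 1" using bound(2)[of n] by linarith
      ultimately show ?thesis using bound(1)[of n] by simp
    qed
    ultimately show "0 \<in> closure {x \<in> {0..1}. convergence_exponent x = 1}"
      unfolding closure_sequential by (intro exI[of _ "\<lambda>n. (pierce_map ^^ n) x"]) simp
  qed (auto intro: preimage)
  moreover have "{x \<in> {0..1}. convergence_exponent x = 0} \<subseteq> {x \<in> {0..1}. convergence_exponent x \<le> 0}"
    and "{x \<in> {0..1}. convergence_exponent x = 1} \<subseteq> {x \<in> {0..1}. 1 \<le> convergence_exponent x}"
    by auto
  ultimately have "{0..1} \<subseteq> closure {x \<in> {0..1}. convergence_exponent x \<le> 0}"
    and "{0..1} \<subseteq> closure {x \<in> {0..1}. 1 \<le> convergence_exponent x}"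
    by (meson closure_mono order_trans)+
  then show ?thesis
    by (intro not_baire_class_one_if_dense_gap[where a = 0 and b = 1]) auto
qed

end
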